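(* Let $n\ge6$ and let $R_n$ be the complex Lie algebra with basis $(e_1,\ldots,e_n)$ and Lie brackets $[e_1,e_i]=e_{i+1}$ for $2\le i\le n-1$ and $[e_2,e_i]=e_{i+2}$ for $3\le i\le n-2$ (all other brackets of basis vectors not obtained by skew-symmetry being zero). Every CPA-structure on $R_n$ is either of type 1, with products $$e_1\cdot e_1=\alpha_3e_3+\cdots+\alpha_ne_n,$$ $$e_1\cdot e_2=\alpha_3e_4+\cdots+\alpha_{n-2}e_{n-1}+\beta e_n,$$ $$e_2\cdot e_2=\alpha_3e_5+\cdots+\alpha_{n-3}e_{n-1}+\gamma e_n,$$ for some parameters $\alpha_3,\ldots,\alpha_n,\beta,\gamma\in\mathbb{C}$, or of type 2, i.e. it is a product $\circ$ with $$e_1\circ e_i=e_1\cdot e_i+[e_1,e_i]\ (1\le i\le n),\quad e_2\circ e_2=2e_4+e_2\cdot e_2,\quad e_2\circ e_i=[e_2,e_i]\ (3\le i\le n),$$ where $\cdot$ is a CPA-structure of type 1.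
   Context: A commutative post-Lie algebra structure (CPA-structure) on a Lie algebra $\mathfrak{g}=(V,[\,,])$ is a bilinear product $x\cdot y$ on $V$ such that for all $x,y,z\in V$: $x\cdot y=y\cdot x$; $[x,y]\cdot z=x\cdot(y\cdot z)-y\cdot(x\cdot z)$; $x\cdot[y,z]=[x\cdot y,z]+[y,x\cdot z]$. Products of basis vectors are listed only for pairs $(i,j)$ with $i\le j$; all products for $i\le j$ not listed are zero, and those with $i>j$ are determined by commutativity. *)

theory Defs
  imports Complex_Main
begin

definition bilinear_product ::
  "(complex \<Rightarrow> 'a::ab_group_add \<Rightarrow> 'a) \<Rightarrow> ('a \<Rightarrow> 'a \<Rightarrow> 'a) \<Rightarrow> bool" where
  "bilinear_product scale f \<longleftrightarrow>
     (\<forall>x. Vector_Spaces.linear scale scale (\<lambda>y. f x y)) \<and>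
     (\<forall>y. Vector_Spaces.linear scale scale (\<lambda>x. f x y))"

locale complex_lie_algebra = vector_space scale
  for scale :: "complex \<Rightarrow> 'a::ab_group_add \<Rightarrow> 'a" +
  fixes bracket :: "'a \<Rightarrow> 'a \<Rightarrow> 'a"
  assumes bracket_bilinear: "bilinear_product scale bracket"
    and bracket_self: "bracket x x = 0"
    and jacobi: "bracket x (bracket y z) + bracket y (bracket z x) + bracket z (bracket x y) = 0"

definition cpa_structure ::
  "(complex \<Rightarrow> 'a::ab_group_add \<Rightarrow> 'a) \<Rightarrow> ('a \<Rightarrow> 'a \<Rightarrow> 'a) \<Rightarrow> ('a \<Rightarrow> 'a \<Rightarrow> 'a) \<Rightarrow> bool" where
  "cpa_structure scale bracket p \<longleftrightarrow>
     bilinear_product scale p \<and>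
     (\<forall>x y. p x y = p y x) \<and>
     (\<forall>x y z. p (bracket x y) z = p x (p y z) - p y (p x z)) \<and>
     (\<forall>x y z. p x (bracket y z) = bracket (p x y) z + bracket y (p x z))"

text \<open>
  The basis is the family \<open>e 1, \<dots>, e n\<close>; values of \<open>e\<close> outside \<open>{1..n}\<close> are irrelevant.
  A Lie algebra is an instance of \<open>lie_algebra_R\<close> exactly if it is the algebra \<open>R\<^sub>n\<close>
  with \<open>e\<close> as its distinguished basis.
\<close>

locale lie_algebra_R = complex_lie_algebra scale bracket
  for scale :: "complex \<Rightarrow> 'a::ab_group_add \<Rightarrow> 'a"
    and bracket :: "'a \<Rightarrow> 'a \<Rightarrow> 'a" +
  fixes n :: nat and e :: "nat \<Rightarrow> 'a"
  assumes basis_inj: "inj_on e {1..n}"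
    and basis_independent: "independent (e ` {1..n})"
    and basis_span: "span (e ` {1..n}) = UNIV"
    and bracket_1: "2 \<le> i \<Longrightarrow> i \<le> n - 1 \<Longrightarrow> bracket (e 1) (e i) = e (i + 1)"
    and bracket_2: "3 \<le> i \<Longrightarrow> i \<le> n - 2 \<Longrightarrow> bracket (e 2) (e i) = e (i + 2)"
    and bracket_other: "1 \<le> i \<Longrightarrow> i < j \<Longrightarrow> j \<le> n \<Longrightarrow>
       \<not> (i = 1 \<and> 2 \<le> j \<and> j \<le> n - 1) \<Longrightarrow> \<not> (i = 2 \<and> 3 \<le> j \<and> j \<le> n - 2) \<Longrightarrow>
       bracket (e i) (e j) = 0"

definition cpa_type1 ::
  "(complex \<Rightarrow> 'a::ab_group_add \<Rightarrow> 'a) \<Rightarrow> ('a \<Rightarrow> 'a \<Rightarrow> 'a) \<Rightarrow> nat \<Rightarrow> (nat \<Rightarrow> 'a) \<Rightarrow>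
     ('a \<Rightarrow> 'a \<Rightarrow> 'a) \<Rightarrow> bool" where
  "cpa_type1 scale bracket n e p \<longleftrightarrow>
     cpa_structure scale bracket p \<and>
     (\<exists>(\<alpha> :: nat \<Rightarrow> complex) (\<beta> :: complex) (\<gamma> :: complex).
        p (e 1) (e 1) = (\<Sum>i = 3..n. scale (\<alpha> i) (e i)) \<and>
        p (e 1) (e 2) = (\<Sum>i = 3..n - 2. scale (\<alpha> i) (e (i + 1))) + scale \<beta> (e n) \<and>
        p (e 2) (e 2) = (\<Sum>i = 3..n - 3. scale (\<alpha> i) (e (i + 2))) + scale \<gamma> (e n) \<and>
        (\<forall>i j. 1 \<le> i \<and> i \<le> j \<and> j \<le> n \<and> (i, j) \<notin> {(1, 1), (1, 2), (2, 2)} \<longrightarrow>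
           p (e i) (e j) = 0))"

definition cpa_type2 ::
  "(complex \<Rightarrow> 'a::ab_group_add \<Rightarrow> 'a) \<Rightarrow> ('a \<Rightarrow> 'a \<Rightarrow> 'a) \<Rightarrow> nat \<Rightarrow> (nat \<Rightarrow> 'a) \<Rightarrow>
     ('a \<Rightarrow> 'a \<Rightarrow> 'a) \<Rightarrow> bool" where
  "cpa_type2 scale bracket n e q \<longleftrightarrow>
     cpa_structure scale bracket q \<and>
     (\<exists>p. cpa_type1 scale bracket n e p \<and>
        (\<forall>i. 1 \<le> i \<and> i \<le> n \<longrightarrow> q (e 1) (e i) = p (e 1) (e i) + bracket (e 1) (e i)) \<and>
        q (e 2) (e 2) = scale 2 (e 4) + p (e 2) (e 2) \<and>
        (\<forall>i. 3 \<le> i \<and> i \<le> n \<longrightarrow> q (e 2) (e i) = bracket (e 2) (e i)) \<and>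
        (\<forall>i j. 3 \<le> i \<and> i \<le> j \<and> j \<le> n \<longrightarrow> q (e i) (e j) = 0))"

end

theory Submission
  imports Defs "HOL-Computational_Algebra.Formal_Power_Series"
begin

unbundle fps_syntax

text \<open>
  Let \<open>W = span {e 3, \<dots>, e n}\<close>, identified with \<open>\<complex>[X] / (X\<^sup>n\<^sup>-\<^sup>2)\<close> so that the brackets with \<open>e 1\<close> and \<open>e 2\<close>
  are multiplication by \<open>X\<close> and \<open>X\<^sup>2\<close>. Each left multiplication of a CPA-structure is a derivation, and
  the shape of derivations together with commutativity puts
  \<open>u = e 1 \<cdot> e 1\<close>, \<open>v = e 1 \<cdot> e 2\<close>, \<open>w = e 2 \<cdot> e 2\<close> into \<open>W\<close>; moreover \<open>e 1\<close> and \<open>e 2\<close> act on \<open>W\<close> as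
  multiplication by \<open>P = X v - X\<^sup>2 u\<close> and \<open>Q = X w - X\<^sup>2 v\<close>. The representation axiom gives
  \<open>P (P - X) = Q (P - X) = P (Q - X\<^sup>2) = 0\<close>, \<open>P v - Q u = P\<close> and \<open>P w - Q v = Q\<close>, and as the ring is local
  this forces \<open>P = Q = 0\<close> (type 1) or \<open>P = X\<close>, \<open>Q = X\<^sup>2\<close> (type 2). In the second case replacing \<open>v\<close> by
  \<open>v - 1\<close> and \<open>w\<close> by \<open>w - 2 X\<close> gives the underlying structure of type 1.
\<close>

section \<open>Power series: divisibility by powers of X and the local-ring dichotomy\<close>

lemma fps_X_power_dvd_iff_nth:
  fixes f :: "'a::comm_ring_1 fps"
  shows "fps_X ^ m dvd f \<longleftrightarrow> (\<forall>k<m. f $ k = 0)"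
proof
  assume "fps_X ^ m dvd f"
  then show "\<forall>k<m. f $ k = 0"
    by (auto simp: dvd_def fps_X_power_mult_nth)
next
  assume "\<forall>k<m. f $ k = 0"
  then have "f = fps_X ^ m * fps_shift m f"
    by (intro fps_ext) (auto simp: fps_X_power_mult_nth)
  then show "fps_X ^ m dvd f" by (metis dvd_triv_left)
qed

lemma fps_X_dvd_iff_nth_0: "fps_X dvd (f :: 'a::comm_ring_1 fps) \<longleftrightarrow> f $ 0 = 0"
  using fps_X_power_dvd_iff_nth[of 1 f] by simp

lemma fps_X_power_add_dvd_iff:
  "fps_X ^ (j + k) dvd fps_X ^ j * (f :: 'a::field fps) \<longleftrightarrow> fps_X ^ k dvd f"
  by (simp add: power_add)

lemma fps_X_mult_shift_1_add_const:
  "f = fps_const (f $ 0) + fps_X * fps_shift 1 (f :: 'a::comm_ring_1 fps)"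
  by (rule fps_ext) auto

lemma fps_dvd_unit_mult_cancel:
  fixes f g h :: "'a::field fps"
  assumes "f dvd g * h" "g $ 0 \<noteq> 0"
  shows "f dvd h"
  using assms by (metis dvd_mult_unit_iff' fps_is_unit_iff)

text \<open>Divide \<open>P\<close> and \<open>Q\<close> by X. One of \<open>P'\<close> and
  \<open>P' - 1\<close> is a unit, so the three quadratic conditions determine \<open>P\<close> and
  \<open>Q\<close>, but only modulo X^(k+1). The missing degree comes from \<open>R1\<close> and
  \<open>R2\<close>, by comparing constant terms of the cofactors.\<close>

lemma fps_idempotent_pair_cases:
  fixes u v w :: "'a::field fps"
  assumes k: "k \<ge> 2"
    and P: "P = fps_X * v - fps_X\<^sup>2 * u"
    and Q: "Q = fps_X * w - fps_X\<^sup>2 * v"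
    and PP: "fps_X ^ (2 + k) dvd P * (P - fps_X)"
    and QP: "fps_X ^ (2 + k) dvd Q * (P - fps_X)"
    and PQ: "fps_X ^ (2 + k) dvd P * (Q - fps_X\<^sup>2)"
    and R1: "fps_X ^ (2 + k) dvd P * v - Q * u - P"
    and R2: "fps_X ^ (2 + k) dvd P * w - Q * v - Q"
  shows "fps_X ^ (2 + k) dvd P \<and> fps_X ^ (2 + k) dvd Q \<or>
         fps_X ^ (2 + k) dvd P - fps_X \<and> fps_X ^ (2 + k) dvd Q - fps_X\<^sup>2"
proof -
  define P' Q' where "P' = v - fps_X * u" and "Q' = w - fps_X * v"
  have PX: "P = fps_X * P'" and QX: "Q = fps_X * Q'"
    by (simp_all add: P Q P'_def Q'_def algebra_simps power2_eq_square)
  have v: "v = P' + fps_X * u" and w: "w = Q' + fps_X * v"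
    by (simp_all add: P'_def Q'_def)
  have "P * (P - fps_X) = fps_X\<^sup>2 * (P' * (P' - 1))"
    by (simp add: PX algebra_simps power2_eq_square)
  then have PP': "fps_X ^ k dvd P' * (P' - 1)"
    using PP by (simp only: fps_X_power_add_dvd_iff)
  have "Q * (P - fps_X) = fps_X\<^sup>2 * ((P' - 1) * Q')"
    by (simp add: PX QX algebra_simps power2_eq_square)
  then have QP': "fps_X ^ k dvd (P' - 1) * Q'"
    using QP by (simp only: fps_X_power_add_dvd_iff)
  have "P * (Q - fps_X\<^sup>2) = fps_X\<^sup>2 * (P' * (Q' - fps_X))"
    by (simp add: PX QX algebra_simps power2_eq_square)
  then have PQ': "fps_X ^ k dvd P' * (Q' - fps_X)"
    using PQ by (simp only: fps_X_power_add_dvd_iff)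
  have Xk: "fps_X dvd (fps_X ^ k :: 'a fps)" using k by (simp add: dvd_power)
  \<comment> \<open>The factor X of \<open>r\<close> is the one degree between the exponent k+1
    reached below and the required k+2.\<close>
  have lift: "fps_X ^ (2 + k) dvd fps_X ^ (Suc k) * r" if "fps_X dvd r" for r :: "'a fps"
    using that fps_X_power_add_dvd_iff[of "Suc k" 1 r] by simp
  have unlift: "fps_X dvd r" if "fps_X ^ (2 + k) dvd fps_X ^ (Suc k) * r" for r :: "'a fps"
    using that fps_X_power_add_dvd_iff[of "Suc k" 1 r] by simp
  show ?thesis
  proof (cases "P' $ 0 = 0")
    case True
    then have unit: "(P' - 1) $ 0 \<noteq> 0" by simp
    have "fps_X ^ k dvd P'"
      using PP' unit by (metis fps_dvd_unit_mult_cancel mult.commute)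
    then obtain p where p: "P' = fps_X ^ k * p" by (elim dvdE)
    have "fps_X ^ k dvd Q'"
      using QP' unit by (rule fps_dvd_unit_mult_cancel)
    then obtain q where q: "Q' = fps_X ^ k * q" by (elim dvdE)
    have "fps_X dvd v" "fps_X dvd w"
      unfolding w v p q using Xk by auto
    have "P * w - Q * v - Q = fps_X ^ Suc k * (p * w - q * v - q)"
      by (simp add: PX QX p q algebra_simps)
    then have "fps_X dvd p * w - q * v - q" using R2 by (simp only: unlift)
    \<comment> \<open>In the constant term only \<open>q\<close> survives, since \<open>v\<close>
      and \<open>w\<close> vanish at 0.\<close>
    then have Xq: "fps_X dvd q"
      using \<open>fps_X dvd v\<close> \<open>fps_X dvd w\<close> by (simp add: fps_X_dvd_iff_nth_0)
    have "P * v - Q * u - P = fps_X ^ Suc k * (p * v - q * u - p)"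
      by (simp add: PX QX p q algebra_simps)
    then have "fps_X dvd p * v - q * u - p" using R1 by (simp only: unlift)
    then have Xp: "fps_X dvd p"
      using \<open>fps_X dvd v\<close> Xq by (simp add: fps_X_dvd_iff_nth_0)
    have "P = fps_X ^ Suc k * p" "Q = fps_X ^ Suc k * q"
      by (simp_all add: PX QX p q mult.assoc)
    then show ?thesis using lift[OF Xp] lift[OF Xq] by metis
  next
    case False
    have "fps_X ^ k dvd P' - 1"
      using PP' False by (rule fps_dvd_unit_mult_cancel)
    then obtain p where p: "P' - 1 = fps_X ^ k * p" by (elim dvdE)
    have "fps_X ^ k dvd Q' - fps_X"
      using PQ' False by (rule fps_dvd_unit_mult_cancel)
    then obtain q where q: "Q' - fps_X = fps_X ^ k * q" by (elim dvdE)
    have P'eq: "P' = 1 + fps_X ^ k * p" and Q'eq: "Q' = fps_X + fps_X ^ k * q"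
      using p q by (simp_all add: algebra_simps)
    have "v $ 0 \<noteq> 0" using False by (simp add: v)
    have "fps_X dvd w"
      unfolding w Q'eq using Xk by auto
    \<comment> \<open>The first summand vanishes by the definition of \<open>Q'\<close>. The error
      term isolates \<open>q\<close>, because \<open>v\<close> is a unit and \<open>w\<close> is
      not.\<close>
    have "P * w - Q * v - Q = fps_X * (w - Q' - fps_X * v) + fps_X ^ Suc k * (p * w - q * v)"
      by (simp add: PX QX P'eq Q'eq algebra_simps)
    moreover have "w - Q' - fps_X * v = 0" by (simp add: Q'_def)
    ultimately have "P * w - Q * v - Q = fps_X ^ Suc k * (p * w - q * v)" by (simp only: mult_zero_right add_0)
    then have "fps_X dvd p * w - q * v" using R2 by (simp only: unlift)
    then have Xq: "fps_X dvd q"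
      using \<open>v $ 0 \<noteq> 0\<close> \<open>fps_X dvd w\<close> by (simp add: fps_X_dvd_iff_nth_0)
    have "P * v - Q * u - P = fps_X * (v - fps_X * u - P') + fps_X ^ Suc k * (p * v - q * u)"
      by (simp add: PX QX P'eq Q'eq algebra_simps)
    moreover have "v - fps_X * u - P' = 0" by (simp add: P'_def)
    ultimately have "P * v - Q * u - P = fps_X ^ Suc k * (p * v - q * u)" by (simp only: mult_zero_right add_0)
    then have "fps_X dvd p * v - q * u" using R1 by (simp only: unlift)
    then have Xp: "fps_X dvd p"
      using \<open>v $ 0 \<noteq> 0\<close> Xq by (simp add: fps_X_dvd_iff_nth_0)
    have "P - fps_X = fps_X ^ Suc k * p" "Q - fps_X\<^sup>2 = fps_X ^ Suc k * q"
      by (simp_all add: PX QX P'eq Q'eq algebra_simps power2_eq_square)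
    then show ?thesis using lift[OF Xp] lift[OF Xq] by metis
  qed
qed

section \<open>Linearity rules for bilinear products\<close>

lemma bilinear_product_simps:
  assumes "bilinear_product scale f"
  shows "f (x + y) z = f x z + f y z" "f x (y + z) = f x y + f x z"
    "f (scale c x) z = scale c (f x z)" "f x (scale c z) = scale c (f x z)"
    "f 0 z = 0" "f x 0 = 0" "f (- x) z = - f x z" "f x (- z) = - f x z"
    "f (x - y) z = f x z - f y z" "f x (y - z) = f x y - f x z"
    "f (sum g A) z = (\<Sum>i\<in>A. f (g i) z)" "f x (sum g A) = (\<Sum>i\<in>A. f x (g i))"
proof -
  have L: "Vector_Spaces.linear scale scale (f x)" "Vector_Spaces.linear scale scale (\<lambda>x. f x y)" for x y
    using assms by (auto simp: bilinear_product_def)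
  show "f (x + y) z = f x z + f y z" "f x (y + z) = f x y + f x z"
    "f (scale c x) z = scale c (f x z)" "f x (scale c z) = scale c (f x z)"
    using L by (simp_all add: Vector_Spaces.linear_iff)
  from L have H: "module_hom scale scale (f x)" "module_hom scale scale (\<lambda>x. f x y)" for x y
    by (simp_all add: Vector_Spaces.linear_iff_module_hom)
  show "f 0 z = 0" "f x 0 = 0" "f (- x) z = - f x z" "f x (- z) = - f x z"
    "f (x - y) z = f x z - f y z" "f x (y - z) = f x y - f x z"
    "f (sum g A) z = (\<Sum>i\<in>A. f (g i) z)" "f x (sum g A) = (\<Sum>i\<in>A. f x (g i))"
    using module_hom.zero[OF H(1)] module_hom.zero[OF H(2)] module_hom.neg[OF H(1)] module_hom.neg[OF H(2)]
      module_hom.diff[OF H(1)] module_hom.diff[OF H(2)] module_hom.sum[OF H(1)] module_hom.sum[OF H(2)]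
    by simp_all
qed

section \<open>Coordinates and the power series model of the commutator ideal\<close>

locale lie_algebra_R6 = lie_algebra_R +
  assumes n6: "n \<ge> 6"
begin

text \<open>Keeps \<open>e 1\<close> and \<open>coord 1\<close> from becoming
  \<open>e (Suc 0)\<close> and \<open>coord (Suc 0)\<close> during simplification.\<close>

declare One_nat_def [simp del]

definition coord :: "nat \<Rightarrow> 'a \<Rightarrow> complex" where
  "coord i x = representation (e ` {1..n}) x (e i)"

text \<open>
  The commutator ideal \<open>span {e 3, \<dots>, e n}\<close> is identified with \<open>\<complex>[[X]] / (X\<^sup>n\<^sup>-\<^sup>2)\<close>, with \<open>e (k + 3)\<close>
  corresponding to \<open>X\<^sup>k\<close>. Bracketing with \<open>e 1\<close> and \<open>e 2\<close> becomes multiplication by \<open>X\<close> and \<open>X\<^sup>2\<close>.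
\<close>

definition tail :: "complex fps \<Rightarrow> 'a" where
  "tail f = (\<Sum>k<n - 2. scale (f $ k) (e (k + 3)))"

lemma coord_add: "coord i (x + y) = coord i x + coord i y"
  by (simp add: coord_def representation_add basis_independent basis_span)

lemma coord_scale: "coord i (scale c x) = c * coord i x"
  by (simp add: coord_def representation_scale basis_independent basis_span)

lemma coord_sum: "coord i (sum g A) = (\<Sum>a\<in>A. coord i (g a))"
  by (simp add: coord_def representation_sum basis_independent basis_span)

lemma coord_e: "i \<in> {1..n} \<Longrightarrow> j \<in> {1..n} \<Longrightarrow> coord i (e j) = (if i = j then 1 else 0)"
  using basis_inj by (auto simp: coord_def representation_basis basis_independent inj_on_eq_iff)

lemma sum_coord_e: "(\<Sum>i=1..n. scale (coord i x) (e i)) = x"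
proof -
  have "(\<Sum>b\<in>e ` {1..n}. scale (representation (e ` {1..n}) x b) b) = x"
    by (rule sum_representation_eq) (auto simp: basis_independent basis_span)
  then show ?thesis
    by (simp add: sum.reindex[OF basis_inj] coord_def o_def)
qed

lemma tail_add: "tail (f + g) = tail f + tail g"
  by (simp add: tail_def scale_left_distrib sum.distrib)

lemma tail_diff: "tail (f - g) = tail f - tail g"
  by (simp add: tail_def scale_left_diff_distrib sum_subtractf)

lemma tail_uminus: "tail (- f) = - tail f"
  by (simp add: tail_def sum_negf)

lemma tail_const_mult: "tail (fps_const c * f) = scale c (tail f)"
  by (simp add: tail_def scale_sum_right)

lemma coord_tail: "coord (k + 3) (tail f) = f $ k" if "k < n - 2"
proof -
  have "coord (k + 3) (tail f) = (\<Sum>j<n - 2. f $ j * (if k = j then 1 else 0))"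
    unfolding tail_def coord_sum coord_scale
    using that by (intro sum.cong refl arg_cong2[where f="(*)"]) (simp add: coord_e)
  also have "\<dots> = (\<Sum>j<n - 2. if k = j then f $ j else 0)"
    by (intro sum.cong) auto
  finally show ?thesis using that by simp
qed

lemma coord_tail_1_2: "coord 1 (tail f) = 0" "coord 2 (tail f) = 0"
  using n6 by (simp_all add: tail_def coord_sum coord_scale coord_e)

text \<open>The coefficients below n - 2 are the coordinates along \<open>e 3\<close> to
  \<open>e n\<close>; the others are cut off. Through this kernel, equations between vectors become
  divisibilities of power series.\<close>

lemma tail_eq_0_iff: "tail f = 0 \<longleftrightarrow> fps_X ^ (n - 2) dvd f"
proof
  assume "tail f = 0"
  moreover have "coord i 0 = 0" for i using coord_scale[of i 0 0] by simp
  ultimately show "fps_X ^ (n - 2) dvd f"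
    using coord_tail[of _ f] by (simp add: fps_X_power_dvd_iff_nth)
next
  assume "fps_X ^ (n - 2) dvd f"
  then show "tail f = 0" by (simp add: fps_X_power_dvd_iff_nth tail_def)
qed

lemma tail_eq_iff: "tail f = tail g \<longleftrightarrow> fps_X ^ (n - 2) dvd f - g"
  using tail_eq_0_iff[of "f - g"] by (simp add: tail_diff)

lemma tail_0: "tail 0 = 0" by (simp add: tail_eq_0_iff)

lemma e_eq_tail: "e j = tail (fps_X ^ (j - 3))" if "3 \<le> j" "j \<le> n"
proof -
  have "tail (fps_X ^ (j - 3)) = (\<Sum>k<n - 2. if k = j - 3 then e (k + 3) else 0)"
    unfolding tail_def by (intro sum.cong) auto
  moreover have "j - 3 < n - 2" "j - 3 + 3 = j" using that n6 by auto
  ultimately show ?thesis by simp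
qed

lemma e_1_2_tail_cases:
  obtains f where "x = scale (coord 1 x) (e 1) + scale (coord 2 x) (e 2) + tail f"
proof -
  \<comment> \<open>For k >= n - 2 the coefficient has no meaning, but \<open>tail\<close> cuts it
    off.\<close>
  define f where "f = Abs_fps (\<lambda>k. coord (k + 3) x)"
  have "{1..n} = {1, 2} \<union> {3..n}" using n6 by auto
  then have "x = (\<Sum>i\<in>{1, 2} \<union> {3..n}. scale (coord i x) (e i))"
    using sum_coord_e[of x] by simp
  also have "\<dots> = scale (coord 1 x) (e 1) + scale (coord 2 x) (e 2) +
      (\<Sum>i=3..n. scale (coord i x) (e i))"
    by (subst sum.union_disjoint) auto
  also have "(\<Sum>i=3..n. scale (coord i x) (e i)) = tail f"
    unfolding tail_def
    by (rule sum.reindex_bij_witness[of _ "\<lambda>k. k + 3" "\<lambda>i. i - 3"]) (auto simp: f_def)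
  finally show ?thesis by (rule that)
qed

section \<open>Brackets in the power series model\<close>

lemmas bracket_simps = bilinear_product_simps[OF bracket_bilinear]

lemma bracket_commute: "bracket y x = - bracket x y"
proof -
  have "bracket (x + y) (x + y) = bracket x x + bracket x y + (bracket y x + bracket y y)"
    by (simp only: bracket_simps add_ac)
  then have "bracket x y + bracket y x = 0" by (simp add: bracket_self)
  then show ?thesis by (simp add: eq_neg_iff_add_eq_0 add.commute)
qed

lemma bracket_e1_e2: "bracket (e 1) (e 2) = tail 1"
  using bracket_1[of 2] n6 e_eq_tail[of 3] by simp

lemma bracket_e1_tail: "bracket (e 1) (tail f) = tail (fps_X * f)"
proof -
  \<comment> \<open>Splits off the last summand: it belongs to \<open>e n\<close>, which
    \<open>e 1\<close> kills. This matches the truncation at X^(n-2).\<close>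
  obtain j where j: "n - 2 = Suc j" using n6 by (cases "n - 2") auto
  have "bracket (e 1) (tail f) = (\<Sum>k<Suc j. scale (f $ k) (bracket (e 1) (e (k + 3))))"
    by (simp add: tail_def j bracket_simps)
  also have "\<dots> = (\<Sum>k<j. scale (f $ k) (bracket (e 1) (e (k + 3))))"
    using bracket_other[of 1 "j + 3"] j by simp
  also have "\<dots> = (\<Sum>k<j. scale (f $ k) (e (k + 4)))"
    using j by (intro sum.cong) (auto simp: bracket_1 add.commute)
  also have "\<dots> = tail (fps_X * f)"
  proof -
    have "Suc k + 3 = k + 4" for k by simp
    then show ?thesis
      unfolding tail_def j by (simp add: sum.lessThan_Suc_shift add.commute del: sum.lessThan_Suc add_Suc)
  qed
  finally show ?thesis .
qed

lemma bracket_e2_tail: "bracket (e 2) (tail f) = tail (fps_X\<^sup>2 * f)"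
proof -
  \<comment> \<open>Here two summands are split off, as \<open>e 2\<close> kills both
    \<open>e (n - 1)\<close> and \<open>e n\<close>.\<close>
  obtain j where j: "n - 2 = Suc (Suc j)" using n6 by (auto simp: numeral_eq_Suc dest!: le_Suc_ex)
  have "bracket (e 2) (tail f) = (\<Sum>k<Suc (Suc j). scale (f $ k) (bracket (e 2) (e (k + 3))))"
    by (simp add: tail_def j bracket_simps)
  also have "\<dots> = (\<Sum>k<j. scale (f $ k) (bracket (e 2) (e (k + 3))))"
    using bracket_other[of 2 "j + 3"] bracket_other[of 2 "j + 4"] j by (simp add: add.commute)
  also have "\<dots> = (\<Sum>k<j. scale (f $ k) (e (k + 5)))"
    using j by (intro sum.cong) (auto simp: bracket_2 add.commute)
  also have "\<dots> = tail (fps_X\<^sup>2 * f)"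
  proof -
    have "Suc (Suc k) + 3 = k + 5" "\<not> Suc (Suc k) < 2" "Suc (Suc k) - 2 = k" for k by simp_all
    then show ?thesis
      unfolding tail_def j
      by (simp add: sum.lessThan_Suc_shift fps_X_power_mult_nth add.commute del: sum.lessThan_Suc add_Suc)
  qed
  finally show ?thesis .
qed

lemma bracket_tail_tail: "bracket (tail f) (tail g) = 0"
proof -
  have ord: "bracket (e i) (e j) = 0" if "3 \<le> i" "i < j" "j \<le> n" for i j
    using that by (intro bracket_other) auto
  have "bracket (e i) (e j) = 0" if "3 \<le> i" "i \<le> n" "3 \<le> j" "j \<le> n" for i j
    using that ord[of i j] ord[of j i] bracket_commute[of "e i" "e j"]
    by (cases i j rule: linorder_cases) (auto simp: bracket_self)
  then show ?thesis
    by (simp add: tail_def bracket_simps)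
qed

text \<open>\<open>W\<close> is abelian, so \<open>x\<close> acts on it only through its class
  modulo \<open>W\<close>.\<close>

lemma bracket_tail:
  "bracket x (tail f) = tail ((fps_const (coord 1 x) * fps_X + fps_const (coord 2 x) * fps_X\<^sup>2) * f)"
proof -
  obtain g where g: "x = scale (coord 1 x) (e 1) + scale (coord 2 x) (e 2) + tail g"
    by (rule e_1_2_tail_cases)
  have "bracket x (tail f) = scale (coord 1 x) (tail (fps_X * f)) + scale (coord 2 x) (tail (fps_X\<^sup>2 * f))"
    by (subst g) (simp add: bracket_simps bracket_tail_tail bracket_e1_tail bracket_e2_tail)
  then show ?thesis
    by (simp add: distrib_right tail_add tail_const_mult mult.assoc)
qed

lemma bracket_eq_tail: "\<exists>f. bracket x y = tail f"
proof -
  obtain g where y: "y = scale (coord 1 y) (e 1) + scale (coord 2 y) (e 2) + tail g"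
    by (rule e_1_2_tail_cases)
  obtain f where x: "x = scale (coord 1 x) (e 1) + scale (coord 2 x) (e 2) + tail f"
    by (rule e_1_2_tail_cases)
  have e1: "\<exists>f. bracket x (e 1) = tail f"
    \<comment> \<open>The witness stays schematic: the flipped rules gather the expanded bracket
      into a single \<open>tail\<close>, which then instantiates it.\<close>
    by (rule exI, subst x)
       (simp add: bracket_simps bracket_self bracket_commute[of "e 2" "e 1"] bracket_commute[of "tail f" "e 1"]
         bracket_e1_tail bracket_e1_e2 flip: tail_const_mult tail_uminus tail_add tail_diff)
  have e2: "\<exists>f. bracket x (e 2) = tail f"
    by (rule exI, subst x)
       (simp add: bracket_simps bracket_self bracket_commute[of "tail f" "e 2"]
         bracket_e2_tail bracket_e1_e2 flip: tail_const_mult tail_uminus tail_add tail_diff)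
  obtain r s where "bracket x (e 1) = tail r" "bracket x (e 2) = tail s"
    using e1 e2 by auto
  then have "bracket x y = scale (coord 1 y) (tail r) + scale (coord 2 y) (tail s) + bracket x (tail g)"
    by (subst y) (simp add: bracket_simps)
  then show ?thesis
    by (auto simp: bracket_tail simp flip: tail_const_mult tail_add)
qed

section \<open>Derivations\<close>

definition derivation :: "('a \<Rightarrow> 'a) \<Rightarrow> bool" where
  "derivation D \<longleftrightarrow> Vector_Spaces.linear scale scale D \<and>
     (\<forall>x y. D (bracket x y) = bracket (D x) y + bracket x (D y))"

lemma derivation_simps:
  assumes "derivation D"
  shows "D (x + y) = D x + D y" "D (scale c x) = scale c (D x)"
    "D (bracket x y) = bracket (D x) y + bracket x (D y)"
  using assms by (simp_all add: derivation_def Vector_Spaces.linear_iff)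

text \<open>The constant term comes from bracketing \<open>e 1\<close> with \<open>e 2\<close>, the
  rest from bracketing with \<open>W\<close>. So \<open>W\<close> consists of brackets, which makes
  it invariant under every derivation.\<close>

lemma tail_eq_bracket_e1: "\<exists>x. tail f = bracket (e 1) x"
proof
  have "bracket (e 1) (scale (f $ 0) (e 2) + tail (fps_shift 1 f)) =
      tail (fps_const (f $ 0) * 1 + fps_X * fps_shift 1 f)"
    by (simp only: bracket_simps bracket_e1_e2 bracket_e1_tail tail_add tail_const_mult)
  then show "tail f = bracket (e 1) (scale (f $ 0) (e 2) + tail (fps_shift 1 f))"
    using fps_X_mult_shift_1_add_const[of f] by simp
qed

lemma derivation_tail_eq_tail: "\<exists>g. D (tail f) = tail g" if D: "derivation D"
proof -
  obtain x where "tail f = bracket (e 1) x" using tail_eq_bracket_e1 by auto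
  moreover obtain r s where "bracket (D (e 1)) x = tail r" "bracket (e 1) (D x) = tail s"
    using bracket_eq_tail by metis
  ultimately have "D (tail f) = tail (r + s)"
    by (simp only: derivation_simps[OF D] tail_add)
  then show ?thesis ..
qed

text \<open>On \<open>W\<close>, bracketing twice with \<open>e 1\<close> equals bracketing once
  with \<open>e 2\<close>. Applying \<open>D\<close> to both resulting expressions for
  \<open>e 5\<close> and comparing coefficients gives the three equations.\<close>

lemma derivation_coord:
  assumes D: "derivation D"
  shows "coord 2 (D (e 1)) = 0" "coord 1 (D (e 2)) = 0" "coord 2 (D (e 2)) = 2 * coord 1 (D (e 1))"
proof -
  define a b c d where "a = fps_const (coord 1 (D (e 1)))" and "b = fps_const (coord 2 (D (e 1)))"
    and "c = fps_const (coord 1 (D (e 2)))" and "d = fps_const (coord 2 (D (e 2)))"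
  obtain h where h: "D (tail 1) = tail h" using derivation_tail_eq_tail[OF D] by auto
  have e1: "D (tail (fps_X * f)) = tail ((a * fps_X + b * fps_X\<^sup>2) * f + fps_X * g)"
    if "D (tail f) = tail g" for f g
  proof -
    have "D (bracket (e 1) (tail f)) = bracket (D (e 1)) (tail f) + bracket (e 1) (tail g)"
      using that by (simp only: derivation_simps[OF D])
    then show ?thesis by (simp only: bracket_tail[of "D (e 1)"] bracket_e1_tail tail_add a_def b_def)
  qed
  have e2: "D (tail (fps_X\<^sup>2 * f)) = tail ((c * fps_X + d * fps_X\<^sup>2) * f + fps_X\<^sup>2 * g)"
    if "D (tail f) = tail g" for f g
  proof -
    have "D (bracket (e 2) (tail f)) = bracket (D (e 2)) (tail f) + bracket (e 2) (tail g)"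
      using that by (simp only: derivation_simps[OF D])
    then show ?thesis by (simp only: bracket_tail[of "D (e 2)"] bracket_e2_tail tail_add c_def d_def)
  qed
  have "fps_X * (fps_X * 1) = (fps_X\<^sup>2 * 1 :: complex fps)" by (simp add: power2_eq_square)
  then have "tail ((a * fps_X + b * fps_X\<^sup>2) * (fps_X * 1) + fps_X * ((a * fps_X + b * fps_X\<^sup>2) * 1 + fps_X * h)) =
      tail ((c * fps_X + d * fps_X\<^sup>2) * 1 + fps_X\<^sup>2 * h)"
    using e1[OF e1[OF h]] e2[OF h] by metis
  then have "fps_X ^ (n - 2) dvd (a * fps_X + b * fps_X\<^sup>2) * (fps_X * 1) +
      fps_X * ((a * fps_X + b * fps_X\<^sup>2) * 1 + fps_X * h) - ((c * fps_X + d * fps_X\<^sup>2) * 1 + fps_X\<^sup>2 * h)"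
    by (simp only: tail_eq_iff)
  also have "(a * fps_X + b * fps_X\<^sup>2) * (fps_X * 1) +
      fps_X * ((a * fps_X + b * fps_X\<^sup>2) * 1 + fps_X * h) - ((c * fps_X + d * fps_X\<^sup>2) * 1 + fps_X\<^sup>2 * h) =
      fps_X * ((2 * a - d) * fps_X + 2 * b * fps_X\<^sup>2 - c)"
    by (simp add: algebra_simps power2_eq_square)
  finally have "\<forall>k<n - 2. (fps_X * ((2 * a - d) * fps_X + 2 * b * fps_X\<^sup>2 - c)) $ k = 0"
    by (simp only: fps_X_power_dvd_iff_nth)
  \<comment> \<open>Degrees 1, 2 and 3 give \<open>c = 0\<close>, \<open>d = 2 * a\<close> and
    \<open>b = 0\<close>; degree 3 survives the truncation because n >= 6.\<close>
  moreover have "Suc 0 < n - 2" "Suc (Suc 0) < n - 2" "Suc (Suc (Suc 0)) < n - 2" using n6 by auto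
  ultimately have "(fps_X * ((2 * a - d) * fps_X + 2 * b * fps_X\<^sup>2 - c)) $ Suc 0 = 0"
    "(fps_X * ((2 * a - d) * fps_X + 2 * b * fps_X\<^sup>2 - c)) $ Suc (Suc 0) = 0"
    "(fps_X * ((2 * a - d) * fps_X + 2 * b * fps_X\<^sup>2 - c)) $ Suc (Suc (Suc 0)) = 0" by blast+
  then show "coord 2 (D (e 1)) = 0" "coord 1 (D (e 2)) = 0" "coord 2 (D (e 2)) = 2 * coord 1 (D (e 1))"
    by (simp_all add: a_def b_def c_def d_def power2_eq_square mult.assoc[symmetric] numeral_fps_const)
qed

text \<open>As \<open>D\<close> sends \<open>e 1\<close> into the abelian ideal \<open>W\<close>, it
  commutes on \<open>W\<close> with the bracket by \<open>e 1\<close>, hence is multiplication by a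
  ring element. That element is the image of 1, read off from \<open>tail 1\<close> as the bracket
  of \<open>e 1\<close> and \<open>e 2\<close>.\<close>

lemma derivation_tail:
  assumes D: "derivation D" and A: "D (e 1) = tail A" and B: "D (e 2) = tail B"
  shows "D (tail f) = tail (f * (fps_X * B - fps_X\<^sup>2 * A))"
proof -
  define h where "h = fps_X * B - fps_X\<^sup>2 * A"
  define E where "E f = D (tail f) - tail (f * h)" for f
  have "D (bracket (e 1) (e 2)) = bracket (tail A) (e 2) + bracket (e 1) (tail B)"
    by (simp only: derivation_simps[OF D] A B)
  then have "D (tail 1) = tail h"
    by (simp add: bracket_e1_e2 bracket_commute[of "tail A"] bracket_e1_tail bracket_e2_tail h_def tail_diff)
  then have E_const: "E (fps_const c) = 0" for c
    using derivation_simps(2)[OF D, of c "tail 1"] tail_const_mult[of c 1] tail_const_mult[of c h]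
    by (simp add: E_def)
  have E_add: "E (f + g) = E f + E g" for f g
    by (simp add: E_def tail_add derivation_simps[OF D] distrib_right)
  have E_X: "E (fps_X * g) = bracket (e 1) (E g)" for g
  proof -
    have "D (bracket (e 1) (tail g)) = bracket (e 1) (D (tail g))"
      by (simp only: derivation_simps[OF D] A bracket_tail_tail add_0)
    then show ?thesis by (simp add: E_def bracket_simps bracket_e1_tail mult.assoc)
  qed
  \<comment> \<open>The defect \<open>E\<close> kills constants and intertwines multiplication by \<open>X\<close> with the bracket with \<open>e 1\<close>,
    so its values lie in every power of this nilpotent operator.\<close>
  have "\<exists>r. E f = tail (fps_X ^ k * r)" for k f
  proof (induction k arbitrary: f)
    case 0
    obtain g where "D (tail f) = tail g" using derivation_tail_eq_tail[OF D] by auto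
    then show ?case by (auto simp: E_def simp flip: tail_diff)
  next
    case (Suc k)
    obtain r where r: "E (fps_shift 1 f) = tail (fps_X ^ k * r)" using Suc by blast
    have "E f = E (fps_const (f $ 0)) + E (fps_X * fps_shift 1 f)"
      using fps_X_mult_shift_1_add_const[of f] E_add by metis
    then have "E f = tail (fps_X ^ Suc k * r)"
      by (simp add: E_const E_X r bracket_e1_tail mult.assoc)
    then show ?case ..
  qed
  then obtain r where "E f = tail (fps_X ^ (n - 2) * r)" by blast
  then have "E f = 0" by (simp add: tail_eq_0_iff)
  then show ?thesis by (simp add: E_def h_def)
qed

section \<open>Type 1: symmetric products that factor through the quotient by
  \<open>W\<close>\<close>

definition tail_product :: "complex fps \<Rightarrow> complex fps \<Rightarrow> complex fps \<Rightarrow> 'a \<Rightarrow> 'a \<Rightarrow> 'a" where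
  "tail_product u v w x y = tail
     (fps_const (coord 1 x * coord 1 y) * u
      + fps_const (coord 1 x * coord 2 y + coord 2 x * coord 1 y) * v
      + fps_const (coord 2 x * coord 2 y) * w)"

lemma tail_product_commute: "tail_product u v w x y = tail_product u v w y x"
  by (simp add: tail_product_def mult.commute add.commute)

lemma tail_product_e:
  "tail_product u v w (e 1) (e 1) = tail u" "tail_product u v w (e 1) (e 2) = tail v"
  "tail_product u v w (e 2) (e 2) = tail w"
  using n6 by (simp_all add: tail_product_def coord_e)

lemma tail_product_tail: "tail_product u v w x (tail f) = 0" "tail_product u v w (tail f) x = 0"
  by (simp_all add: tail_product_def coord_tail_1_2 tail_0)

text \<open>All products and brackets lie in \<open>W\<close>, and products with \<open>W\<close>
  vanish. Only the right-hand side of the derivation rule remains, and the two divisibilities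
  annihilate it.\<close>

lemma cpa_structure_tail_product:
  assumes v: "fps_X ^ (n - 2) dvd fps_X * v - fps_X\<^sup>2 * u"
    and w: "fps_X ^ (n - 2) dvd fps_X * w - fps_X\<^sup>2 * v"
  shows "cpa_structure scale bracket (tail_product u v w)"
proof -
  let ?p = "tail_product u v w"
  have bil: "bilinear_product scale ?p"
    unfolding bilinear_product_def Vector_Spaces.linear_iff
    by (simp add: vector_space_axioms tail_product_def coord_add coord_scale algebra_simps
        flip: tail_add tail_const_mult fps_const_add fps_const_mult)
  have "bracket (?p x y) z + bracket y (?p x z) = 0" for x y z
  proof -
    define F where "F t = fps_const (coord 1 x * coord 1 t) * u
      + fps_const (coord 1 x * coord 2 t + coord 2 x * coord 1 t) * v
      + fps_const (coord 2 x * coord 2 t) * w" for t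
    define M where "M t = fps_const (coord 1 t) * fps_X + fps_const (coord 2 t) * fps_X\<^sup>2" for t
    have p: "?p x t = tail (F t)" for t by (simp add: tail_product_def F_def)
    \<comment> \<open>The expression is skew in \<open>y\<close> and \<open>z\<close>, so the
      determinant of their coordinates factors out.\<close>
    have "M y * F z - M z * F y = fps_const (coord 1 y * coord 2 z - coord 1 z * coord 2 y) *
      (fps_const (coord 1 x) * (fps_X * v - fps_X\<^sup>2 * u) + fps_const (coord 2 x) * (fps_X * w - fps_X\<^sup>2 * v))"
      by (simp add: M_def F_def algebra_simps power2_eq_square
          flip: fps_const_add fps_const_mult fps_const_sub)
    then have "fps_X ^ (n - 2) dvd M y * F z - M z * F y"
      using v w by simp
    moreover have "bracket (?p x y) z = - bracket z (?p x y)" by (rule bracket_commute)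
    ultimately show ?thesis
      by (simp add: p bracket_tail tail_eq_iff flip: M_def)
  qed
  moreover have "?p x (bracket y z) = 0" "?p (bracket x y) z = 0" for x y z
    using bracket_eq_tail tail_product_tail by metis+
  moreover have "?p x (?p y z) = 0" for x y z
    unfolding tail_product_def[of _ _ _ y z] by (rule tail_product_tail)
  ultimately show ?thesis
    unfolding cpa_structure_def using bil tail_product_commute by auto
qed

text \<open>The divisibilities say that \<open>v\<close> agrees with X u and \<open>w\<close> with X
  v except in the top degree, which multiplication by X loses. The coefficients of \<open>v\<close>
  and \<open>w\<close> at \<open>e n\<close> therefore stay free and give \<beta> and
  \<gamma>.\<close>

lemma cpa_type1I:
  assumes p: "cpa_structure scale bracket p"
    and e: "p (e 1) (e 1) = tail u" "p (e 1) (e 2) = tail v" "p (e 2) (e 2) = tail w"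
    and p_tail: "\<And>x f. p x (tail f) = 0"
    and v: "fps_X ^ (n - 2) dvd fps_X * v - fps_X\<^sup>2 * u"
    and w: "fps_X ^ (n - 2) dvd fps_X * w - fps_X\<^sup>2 * v"
  shows "cpa_type1 scale bracket n e p"
proof -
  \<comment> \<open>The degrees run from 0 to j + 2, the last one belonging to
    \<open>e n\<close>.\<close>
  obtain j where j: "n - 2 = Suc (Suc (Suc j))" and n: "n = j + 5"
    using n6 by (auto simp: numeral_eq_Suc dest!: le_Suc_ex)
  have shift: "b $ 0 = 0" "k < Suc j \<Longrightarrow> b $ Suc k = a $ k"
    if "fps_X ^ (n - 2) dvd fps_X * b - fps_X\<^sup>2 * a" for a b :: "complex fps" and k
  proof -
    have *: "\<forall>k<Suc (Suc (Suc j)). (fps_X * b - fps_X\<^sup>2 * a) $ k = 0"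
      using that j by (simp only: fps_X_power_dvd_iff_nth)
    show "b $ 0 = 0" using *[rule_format, of "Suc 0"] by (simp add: fps_X_power_mult_nth)
    have "\<not> Suc (Suc k) < 2" "Suc (Suc k) - 2 = k" by simp_all
    then show "b $ Suc k = a $ k" if "k < Suc j"
      using *[rule_format, of "Suc (Suc k)"] that by (simp add: fps_X_power_mult_nth)
  qed
  have w1: "w $ Suc 0 = 0" using shift(1)[OF v] shift(2)[OF w, of 0] by simp
  have w2: "w $ Suc (Suc k) = u $ k" if "k < j" for k
    using shift(2)[OF w, of "Suc k"] shift(2)[OF v, of k] that by simp
  have sums: "tail u = (\<Sum>i = 3..n. scale (u $ (i - 3)) (e i))"
    "(\<Sum>k<Suc j. scale (u $ k) (e (k + 4))) = (\<Sum>i = 3..n - 2. scale (u $ (i - 3)) (e (i + 1)))"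
    "(\<Sum>k<j. scale (u $ k) (e (k + 5))) = (\<Sum>i = 3..n - 3. scale (u $ (i - 3)) (e (i + 2)))"
    unfolding tail_def
    by (rule sum.reindex_bij_witness[of _ "\<lambda>i. i - 3" "\<lambda>k. k + 3"]; use n in \<open>auto simp: add.commute\<close>)+
  have "tail v = (\<Sum>k<Suc j. scale (v $ Suc k) (e (Suc k + 3))) + scale (v $ Suc (Suc j)) (e n)"
    unfolding tail_def j
    by (subst sum.lessThan_Suc, subst sum.lessThan_Suc_shift) (simp add: shift(1)[OF v] n add.commute)
  also have "(\<Sum>k<Suc j. scale (v $ Suc k) (e (Suc k + 3))) = (\<Sum>k<Suc j. scale (u $ k) (e (k + 4)))"
    by (intro sum.cong refl arg_cong2[where f=scale] arg_cong[where f=e] shift(2)[OF v]) auto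
  finally have tail_v: "tail v = (\<Sum>i = 3..n - 2. scale (u $ (i - 3)) (e (i + 1))) + scale (v $ Suc (Suc j)) (e n)"
    by (simp only: sums)
  have "tail w = (\<Sum>k<j. scale (w $ Suc (Suc k)) (e (Suc (Suc k) + 3))) + scale (w $ Suc (Suc j)) (e n)"
    unfolding tail_def j
    by (subst sum.lessThan_Suc, subst sum.lessThan_Suc_shift, subst sum.lessThan_Suc_shift)
       (simp add: shift(1)[OF w] w1 n add.commute)
  also have "(\<Sum>k<j. scale (w $ Suc (Suc k)) (e (Suc (Suc k) + 3))) = (\<Sum>k<j. scale (u $ k) (e (k + 5)))"
    by (intro sum.cong refl arg_cong2[where f=scale] arg_cong[where f=e] w2) auto
  finally have tail_w: "tail w = (\<Sum>i = 3..n - 3. scale (u $ (i - 3)) (e (i + 2))) + scale (w $ Suc (Suc j)) (e n)"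
    by (simp only: sums)
  have "p (e i) (e j) = 0" if "1 \<le> i" "i \<le> j" "j \<le> n" "(i, j) \<notin> {(1, 1), (1, 2), (2, 2)}" for i j
  proof -
    have "3 \<le> j" using that by (cases "j \<le> 2") auto
    then show ?thesis using e_eq_tail[of j] p_tail that by simp
  qed
  then show ?thesis
    unfolding cpa_type1_def e
    using p by (intro conjI exI[of _ "\<lambda>i. u $ (i - 3)"] exI[of _ "v $ Suc (Suc j)"] exI[of _ "w $ Suc (Suc j)"])
      (simp_all only: sums(1) tail_v tail_w, blast)
qed

section \<open>Classification of CPA-structures\<close>

context
  fixes p :: "'a \<Rightarrow> 'a \<Rightarrow> 'a"
  assumes cpa: "cpa_structure scale bracket p"
begin

lemma cpa_bilinear: "bilinear_product scale p"
  using cpa by (simp add: cpa_structure_def)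

lemmas cpa_simps = bilinear_product_simps[OF cpa_bilinear]

lemma cpa_commute: "p x y = p y x"
  using cpa by (simp add: cpa_structure_def)

lemma cpa_bracket_left: "p (bracket x y) z = p x (p y z) - p y (p x z)"
  using cpa unfolding cpa_structure_def by blast

lemma cpa_derivation: "derivation (p x)"
  using cpa by (simp add: cpa_structure_def derivation_def bilinear_product_def)

text \<open>By commutativity \<open>p (e 1) (e 2)\<close> is both the image of \<open>e 2\<close>
  under one derivation and of \<open>e 1\<close> under another. This kills both of its coordinates
  modulo \<open>W\<close>, and the relations with factor 2 then settle the two squares.\<close>

lemma cpa_e_1_2_eq_tail:
  "\<exists>u. p (e 1) (e 1) = tail u" "\<exists>v. p (e 1) (e 2) = tail v" "\<exists>w. p (e 2) (e 2) = tail w"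
proof -
  have "coord 1 (p (e 1) (e 2)) = 0" "coord 2 (p (e 1) (e 1)) = 0"
    "coord 2 (p (e 1) (e 2)) = 2 * coord 1 (p (e 1) (e 1))"
    using derivation_coord[OF cpa_derivation[of "e 1"]] by auto
  moreover have "coord 1 (p (e 2) (e 2)) = 0" "coord 2 (p (e 2) (e 1)) = 0"
    "coord 2 (p (e 2) (e 2)) = 2 * coord 1 (p (e 2) (e 1))"
    using derivation_coord[OF cpa_derivation[of "e 2"]] by auto
  ultimately have zero: "coord i (p (e k) (e l)) = 0"
    if "i \<in> {1, 2}" "k \<in> {1, 2}" "l \<in> {1, 2}" for i k l
    using that cpa_commute[of "e 2" "e 1"] by auto
  have "\<exists>f. x = tail f" if "coord 1 x = 0" "coord 2 x = 0" for x
    using that by (metis e_1_2_tail_cases[of x] scale_zero_left add_0)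
  then show "\<exists>u. p (e 1) (e 1) = tail u" "\<exists>v. p (e 1) (e 2) = tail v" "\<exists>w. p (e 2) (e 2) = tail w"
    using zero by simp_all
qed

lemma cpa_type1_or_type2: "cpa_type1 scale bracket n e p \<or> cpa_type2 scale bracket n e p"
proof -
  obtain u v w where u: "p (e 1) (e 1) = tail u" and v: "p (e 1) (e 2) = tail v"
    and w: "p (e 2) (e 2) = tail w"
    using cpa_e_1_2_eq_tail by blast
  have v': "p (e 2) (e 1) = tail v" using v cpa_commute by simp
  define P Q where "P = fps_X * v - fps_X\<^sup>2 * u" and "Q = fps_X * w - fps_X\<^sup>2 * v"
  have p1: "p (e 1) (tail f) = tail (f * P)" for f
    unfolding P_def by (rule derivation_tail[OF cpa_derivation u v])
  have p2: "p (e 2) (tail f) = tail (f * Q)" for f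
    unfolding Q_def by (rule derivation_tail[OF cpa_derivation v' w])
  have pt1: "p (tail f) (e 1) = tail (f * P)" and pt2: "p (tail f) (e 2) = tail (f * Q)" for f
    using p1 p2 cpa_commute by simp_all
  have ptt: "p (tail f) (tail g) = tail (g * (fps_X * (f * Q) - fps_X\<^sup>2 * (f * P)))" for f g
    by (rule derivation_tail[OF cpa_derivation pt1 pt2])
  have tail_tail: "p (tail f) (tail g) = 0" for f g
  proof -
    \<comment> \<open>\<open>tail 1\<close> is the bracket of \<open>e 1\<close> and
      \<open>e 2\<close>, so it acts on \<open>W\<close> as the commutator of two multiplications,
      which is zero. At \<open>tail 1\<close> this reads X Q = X^2 P, and \<open>ptt\<close>
      contains the difference as a factor.\<close>
    have "p (tail 1) (tail g) = 0" for g
      using cpa_bracket_left[of "e 1" "e 2" "tail g"]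
      by (simp add: bracket_e1_e2 p1 p2 mult_ac)
    then have "fps_X ^ (n - 2) dvd fps_X * Q - fps_X\<^sup>2 * P"
      using ptt[of 1 1] by (simp add: tail_eq_0_iff)
    then have "fps_X ^ (n - 2) dvd (g * f) * (fps_X * Q - fps_X\<^sup>2 * P)" by (rule dvd_mult)
    then show ?thesis by (simp add: ptt tail_eq_0_iff algebra_simps)
  qed
  \<comment> \<open>The representation axiom for \<open>tail 1\<close> as a bracket, now evaluated
    at \<open>e 1\<close> and \<open>e 2\<close>.\<close>
  have "tail P = tail (v * P - u * Q)" "tail Q = tail (w * P - v * Q)"
    using cpa_bracket_left[of "e 1" "e 2" "e 1"] cpa_bracket_left[of "e 1" "e 2" "e 2"]
    by (simp_all add: bracket_e1_e2 p1 p2 pt1 pt2 u v v' w tail_diff)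
  then have R: "fps_X ^ (n - 2) dvd P * v - Q * u - P" "fps_X ^ (n - 2) dvd P * w - Q * v - Q"
    unfolding tail_eq_iff by (simp_all add: dvd_diff_commute mult.commute)
  \<comment> \<open>In the axiom for a bracket with \<open>tail 1\<close>, the subtracted term is a
    product inside \<open>W\<close> and drops out.\<close>
  have "tail (fps_X * P) = tail (P * P)" "tail (fps_X * Q) = tail (Q * P)"
    using cpa_bracket_left[of "e 1" "tail 1" "e 1"] cpa_bracket_left[of "e 1" "tail 1" "e 2"]
    by (simp_all add: bracket_e1_tail p1 p2 pt1 pt2 u v tail_tail)
  moreover have "tail (fps_X\<^sup>2 * P) = tail (P * Q)"
    using cpa_bracket_left[of "e 2" "tail 1" "e 1"]
    by (simp add: bracket_e2_tail p1 p2 pt1 pt2 v' tail_tail)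
  ultimately have PQ: "fps_X ^ (n - 2) dvd P * (P - fps_X)" "fps_X ^ (n - 2) dvd Q * (P - fps_X)"
    "fps_X ^ (n - 2) dvd P * (Q - fps_X\<^sup>2)"
    unfolding tail_eq_iff by (simp_all add: dvd_diff_commute algebra_simps)
  have n: "2 + (n - 4) = n - 2" "2 \<le> n - 4" using n6 by simp_all
  note PQ_cases = fps_idempotent_pair_cases[of "n - 4" P v u Q w, unfolded n(1), OF n(2) P_def Q_def PQ R]
  then consider (zero) "fps_X ^ (n - 2) dvd P" "fps_X ^ (n - 2) dvd Q"
    | (ad) "fps_X ^ (n - 2) dvd P - fps_X" "fps_X ^ (n - 2) dvd Q - fps_X\<^sup>2"
    by blast
  then show ?thesis
  proof cases
    case zero
    have "p x (tail f) = 0" for x f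
    proof -
      obtain g where g: "x = scale (coord 1 x) (e 1) + scale (coord 2 x) (e 2) + tail g"
        by (rule e_1_2_tail_cases)
      have "tail (f * P) = 0" "tail (f * Q) = 0" using zero by (simp_all add: tail_eq_0_iff)
      then show ?thesis by (subst g) (simp add: cpa_simps p1 p2 tail_tail)
    qed
    then show ?thesis
      using cpa_type1I[OF cpa u v w] zero by (simp add: P_def Q_def)
  next
    case ad
    \<comment> \<open>Removes the adjoint part: \<open>e 1\<close> and \<open>e 2\<close> have
      bracket \<open>e 3\<close>, that is 1, and the extra \<open>scale 2 (e 4)\<close> is 2 X. In
      the type 1 criterion this replaces \<open>P\<close> and \<open>Q\<close> by P - X and Q - X^2,
      which vanish modulo X^(n-2) in this case.\<close>
    define q where "q = tail_product u (v - 1) (w - 2 * fps_X)"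
    have "fps_X * (v - 1) - fps_X\<^sup>2 * u = P - fps_X"
      by (simp add: P_def algebra_simps)
    then have v1: "fps_X ^ (n - 2) dvd fps_X * (v - 1) - fps_X\<^sup>2 * u" using ad by simp
    have "fps_X * (w - 2 * fps_X) - fps_X\<^sup>2 * (v - 1) = Q - fps_X\<^sup>2"
      by (simp add: Q_def algebra_simps power2_eq_square)
    then have w1: "fps_X ^ (n - 2) dvd fps_X * (w - 2 * fps_X) - fps_X\<^sup>2 * (v - 1)" using ad by simp
    have q: "cpa_type1 scale bracket n e q"
      unfolding q_def
      by (rule cpa_type1I[OF cpa_structure_tail_product[OF v1 w1] tail_product_e tail_product_tail(1) v1 w1])
    have ad1: "p (e 1) (tail f) = bracket (e 1) (tail f)" for f
    proof -
      have "fps_X ^ (n - 2) dvd f * (P - fps_X)" using ad by simp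
      then show ?thesis by (simp add: p1 bracket_e1_tail tail_eq_iff algebra_simps)
    qed
    have ad2: "p (e 2) (tail f) = bracket (e 2) (tail f)" for f
    proof -
      have "fps_X ^ (n - 2) dvd f * (Q - fps_X\<^sup>2)" using ad by simp
      then show ?thesis by (simp add: p2 bracket_e2_tail tail_eq_iff algebra_simps)
    qed
    have "p (e 1) (e i) = q (e 1) (e i) + bracket (e 1) (e i)" if "1 \<le> i" "i \<le> n" for i
    proof -
      have "i = 1 \<or> i = 2 \<or> 3 \<le> i" using that by arith
      then consider "i = 1" | "i = 2" | "3 \<le> i" by blast
      then show ?thesis
      proof cases
        case 1
        then show ?thesis by (simp add: u q_def tail_product_e bracket_self)
      next
        case 2
        then show ?thesis by (simp add: v q_def tail_product_e bracket_e1_e2 flip: tail_add)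
      next
        case 3
        then show ?thesis using that by (simp add: e_eq_tail ad1 q_def tail_product_tail)
      qed
    qed
    moreover have "p (e 2) (e 2) = scale 2 (e 4) + q (e 2) (e 2)"
      using n6 by (simp add: w q_def tail_product_e e_eq_tail numeral_fps_const flip: tail_add tail_const_mult)
    moreover have "p (e 2) (e i) = bracket (e 2) (e i)" if "3 \<le> i" "i \<le> n" for i
      using that by (simp add: e_eq_tail ad2)
    moreover have "p (e i) (e j) = 0" if "3 \<le> i" "i \<le> j" "j \<le> n" for i j
      using that by (simp add: e_eq_tail tail_tail)
    ultimately have "cpa_type2 scale bracket n e p"
      unfolding cpa_type2_def using cpa q by auto
    then show ?thesis ..
  qed
qed

end

end

theorem proposition3p13:
  fixes scale :: "complex \<Rightarrow> 'a::ab_group_add \<Rightarrow> 'a"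
    and bracket :: "'a \<Rightarrow> 'a \<Rightarrow> 'a"
    and n :: nat
    and e :: "nat \<Rightarrow> 'a"
    and p :: "'a \<Rightarrow> 'a \<Rightarrow> 'a"
  assumes "n \<ge> 6"
    and "lie_algebra_R scale bracket n e"
    and "cpa_structure scale bracket p"
  shows "cpa_type1 scale bracket n e p \<or> cpa_type2 scale bracket n e p"
proof -
  interpret lie_algebra_R6 scale bracket n e
    using assms(1,2) by (simp add: lie_algebra_R6_def lie_algebra_R6_axioms_def)
  show ?thesis using assms(3) by (rule cpa_type1_or_type2)
qed

end
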